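(* For every integer $n\ge 1$ the following identities hold: (a) $\widehat{K}_n=3\widehat{T}_{n+1}-2\widehat{T}_n-\widehat{T}_{n-1}$; (b) $\widehat{T}_n+\overline{\widehat{T}_n}=2T_n$ and $\widehat{K}_n+\overline{\widehat{K}_n}=2K_n$; (c) $\widehat{T}_{n+1}+\widehat{T}_n=\dfrac{\widehat{\alpha}(\alpha+1)\alpha^{n+1}}{(\alpha-\beta)(\alpha-\gamma)}+\dfrac{\widehat{\beta}(\beta+1)\beta^{n+1}}{(\beta-\alpha)(\beta-\gamma)}+\dfrac{\widehat{\gamma}(\gamma+1)\gamma^{n+1}}{(\gamma-\alpha)(\gamma-\beta)}$; (d) $\widehat{K}_{n+1}+\widehat{K}_n=\widehat{\alpha}(\alpha+1)\alpha^{n}+\widehat{\beta}(\beta+1)\beta^{n}+\widehat{\gamma}(\gamma+1)\gamma^{n}$; (e) $\displaystyle\sum_{i=0}^{n}\binom{n}{i}\widehat{T}_i=\dfrac{\widehat{\alpha}\,\alpha(1+\alpha)^n}{(\alpha-\beta)(\alpha-\gamma)}+\dfrac{\widehat{\beta}\,\beta(1+\beta)^n}{(\beta-\alpha)(\beta-\gamma)}+\dfrac{\widehat{\gamma}\,\gamma(1+\gamma)^n}{(\gamma-\alpha)(\gamma-\beta)}$; (f) $\displaystyle\sum_{i=0}^{n}\binom{n}{i}\widehat{K}_i=\widehat{\alpha}(1+\alpha)^n+\widehat{\beta}(1+\beta)^n+\widehat{\gamma}(1+\gamma)^n$.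
   Context: The Tribonacci numbers are $T_n=T_{n-1}+T_{n-2}+T_{n-3}$ with $T_0=0,T_1=1,T_2=1$, and the Tribonacci-Lucas numbers are $K_n=K_{n-1}+K_{n-2}+K_{n-3}$ with $K_0=3,K_1=1,K_2=3$; both are extended to negative indices so that the recurrences hold for all integers $n$. The sedenions $\mathbb{S}$ are the 16-dimensional real Cayley-Dickson algebra (the double of the octonions) with standard basis $e_0,e_1,\dots,e_{15}$, $e_0=1$ the identity (real numbers $a$ are identified with $a e_0$); addition and multiplication by scalars are componentwise. For every integer $n$, $\widehat{T}_n=\sum_{s=0}^{15}T_{n+s}e_s$ and $\widehat{K}_n=\sum_{s=0}^{15}K_{n+s}e_s$, with conjugates $\overline{\widehat{T}_n}=T_n-\sum_{s=1}^{15}T_{n+s}e_s$ and $\overline{\widehat{K}_n}=K_n-\sum_{s=1}^{15}K_{n+s}e_s$. The numbers $\alpha,\beta,\gamma\in\mathbb{C}$ are the three (distinct) roots of $x^3-x^2-x-1=0$, and $\widehat{\alpha}=\sum_{s=0}^{15}\alpha^s e_s$, $\widehat{\beta}=\sum_{s=0}^{15}\beta^s e_s$, $\widehat{\gamma}=\sum_{s=0}^{15}\gamma^s e_s$. Since $\beta,\gamma$ are non-real, expressions with complex coefficients are taken in the complexification $\mathbb{S}\otimes_{\mathbb{R}}\mathbb{C}$, in which $\mathbb{S}$ is embedded and complex scalars are central. *)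

theory Defs
  imports Complex_Main
begin

section \<open>Tribonacci and Tribonacci-Lucas numbers with integer index\<close>

text \<open>For negative n the recurrence is solved for its lowest term.\<close>

function tribonacci :: "int \<Rightarrow> int" where
  "tribonacci n =
     (if n = 0 then 0 else if n = 1 then 1 else if n = 2 then 1
      else if n > 2 then tribonacci (n - 1) + tribonacci (n - 2) + tribonacci (n - 3)
      else tribonacci (n + 3) - tribonacci (n + 2) - tribonacci (n + 1))"
  by auto
termination
  by (relation "measure (\<lambda>n. if n \<ge> 0 then nat n else nat (2 - n))") auto

function tribonacci_lucas :: "int \<Rightarrow> int" where
  "tribonacci_lucas n =
     (if n = 0 then 3 else if n = 1 then 1 else if n = 2 then 3
      else if n > 2 then
        tribonacci_lucas (n - 1) + tribonacci_lucas (n - 2) + tribonacci_lucas (n - 3)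
      else tribonacci_lucas (n + 3) - tribonacci_lucas (n + 2) - tribonacci_lucas (n + 1))"
  by auto
termination
  by (relation "measure (\<lambda>n. if n \<ge> 0 then nat n else nat (2 - n))") auto

declare tribonacci.simps [simp del] tribonacci_lucas.simps [simp del]

lemma tribonacci_init: "tribonacci 0 = 0" "tribonacci 1 = 1" "tribonacci 2 = 1"
  by (simp_all add: tribonacci.simps)

lemma tribonacci_rec:
  "tribonacci n = tribonacci (n - 1) + tribonacci (n - 2) + tribonacci (n - 3)"
proof (cases "n > 2")
  case True
  then show ?thesis by (simp add: tribonacci.simps [of n])
next
  case False
  then have "tribonacci (n - 3) = tribonacci n - tribonacci (n - 1) - tribonacci (n - 2)"
    by (subst tribonacci.simps) simp
  then show ?thesis by simp
qed

lemma tribonacci_lucas_init: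
  "tribonacci_lucas 0 = 3" "tribonacci_lucas 1 = 1" "tribonacci_lucas 2 = 3"
  by (simp_all add: tribonacci_lucas.simps)

lemma tribonacci_lucas_rec:
  "tribonacci_lucas n =
     tribonacci_lucas (n - 1) + tribonacci_lucas (n - 2) + tribonacci_lucas (n - 3)"
proof (cases "n > 2")
  case True
  then show ?thesis by (simp add: tribonacci_lucas.simps [of n])
next
  case False
  then have "tribonacci_lucas (n - 3) =
      tribonacci_lucas n - tribonacci_lucas (n - 1) - tribonacci_lucas (n - 2)"
    by (subst tribonacci_lucas.simps) simp
  then show ?thesis by simp
qed


section \<open>Sedenions\<close>

text \<open>
  An element of the k-th Cayley-Dickson double of a commutative ring R is represented by its
  coefficient function, supported on the indices below 2^k. The pair (a, b) of elements of the
  k-th double has a as its coefficients at the indices below 2^k and b as those from 2^k on.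
  The ring R itself carries the identity as conjugation, so that unfolding
  (a, b)* = (a*, -b) just negates all coefficients of nonzero index. The product is
  (a, b) (c, d) = (a c - d* b, d a + b c*).
\<close>

definition cd_conj :: "(nat \<Rightarrow> 'a::comm_ring_1) \<Rightarrow> nat \<Rightarrow> 'a" where
  "cd_conj x = (\<lambda>i. if i = 0 then x i else - x i)"

definition cd_fst :: "nat \<Rightarrow> (nat \<Rightarrow> 'a::comm_ring_1) \<Rightarrow> nat \<Rightarrow> 'a" where
  "cd_fst k x = (\<lambda>i. if i < 2 ^ k then x i else 0)"

definition cd_snd :: "nat \<Rightarrow> (nat \<Rightarrow> 'a::comm_ring_1) \<Rightarrow> nat \<Rightarrow> 'a" where
  "cd_snd k x = (\<lambda>i. if i < 2 ^ k then x (i + 2 ^ k) else 0)"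

primrec cd_mult :: "nat \<Rightarrow> (nat \<Rightarrow> 'a::comm_ring_1) \<Rightarrow> (nat \<Rightarrow> 'a) \<Rightarrow> nat \<Rightarrow> 'a" where
  "cd_mult 0 x y = (\<lambda>i. if i = 0 then x 0 * y 0 else 0)"
| "cd_mult (Suc k) x y =
     (let a = cd_fst k x; b = cd_snd k x; c = cd_fst k y; d = cd_snd k y in
      (\<lambda>i. if i < 2 ^ k
            then cd_mult k a c i - cd_mult k (cd_conj d) b i
            else cd_mult k d a (i - 2 ^ k) + cd_mult k b (cd_conj c) (i - 2 ^ k)))"

lemma cd_mult_outside: "i \<ge> 2 ^ k \<Longrightarrow> cd_mult k x y i = 0"
  by (induction k arbitrary: x y i) (auto simp: Let_def)

text \<open>
  Sedenions with coefficients in a commutative ring: the real sedenions are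
  "real sedenion", and their complexification is "complex sedenion", whose product is
  complex bilinear (no complex conjugation of coefficients is involved).
\<close>

typedef (overloaded) 'a sedenion = "{f :: nat \<Rightarrow> 'a::comm_ring_1. \<forall>i\<ge>16. f i = 0}"
  morphisms sed_coeff Abs_sedenion
  by (rule exI [of _ "\<lambda>_. 0"]) simp

setup_lifting type_definition_sedenion

lemma sedenion_eqI: "(\<And>i. i < 16 \<Longrightarrow> sed_coeff x i = sed_coeff y i) \<Longrightarrow> x = y"
  by transfer (metis ext linorder_not_le)

instantiation sedenion :: (comm_ring_1) ab_group_add
begin
lift_definition zero_sedenion :: "'a sedenion" is "\<lambda>_. 0" by simp
lift_definition plus_sedenion :: "'a sedenion \<Rightarrow> 'a sedenion \<Rightarrow> 'a sedenion"
  is "\<lambda>x y i. x i + y i" by simp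
lift_definition minus_sedenion :: "'a sedenion \<Rightarrow> 'a sedenion \<Rightarrow> 'a sedenion"
  is "\<lambda>x y i. x i - y i" by simp
lift_definition uminus_sedenion :: "'a sedenion \<Rightarrow> 'a sedenion"
  is "\<lambda>x i. - x i" by simp
instance
  by (standard; transfer; simp add: fun_eq_iff algebra_simps)
end

instantiation sedenion :: (comm_ring_1) "{times, one}"
begin
lift_definition one_sedenion :: "'a sedenion" is "\<lambda>i. if i = 0 then 1 else 0" by simp
lift_definition times_sedenion :: "'a sedenion \<Rightarrow> 'a sedenion \<Rightarrow> 'a sedenion"
  is "cd_mult 4" by (simp add: cd_mult_outside)
instance ..
end

lift_definition sed_scale :: "'a::comm_ring_1 \<Rightarrow> 'a sedenion \<Rightarrow> 'a sedenion"  (infixr "*\<^sub>S" 75)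
  is "\<lambda>c x i. c * x i" by simp

text \<open>The basis vectors e_0, ..., e_15 (and 0 for larger indices).\<close>

lift_definition sed_basis :: "nat \<Rightarrow> 'a::comm_ring_1 sedenion"
  is "\<lambda>s i. if i = s \<and> s < 16 then 1 else 0" by auto

lift_definition sed_conj :: "'a::comm_ring_1 sedenion \<Rightarrow> 'a sedenion"
  is cd_conj by (simp add: cd_conj_def)

definition sed_real :: "real \<Rightarrow> real sedenion" where
  "sed_real a = a *\<^sub>S sed_basis 0"

text \<open>The embedding of the sedenions into their complexification.\<close>

lift_definition sed_complexify :: "real sedenion \<Rightarrow> complex sedenion"
  is "\<lambda>x i. complex_of_real (x i)" by simp

lemma sed_coeff_simps [simp]:
  "sed_coeff 0 i = 0"
  "sed_coeff (x + y) i = sed_coeff x i + sed_coeff y i"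
  "sed_coeff (x - y) i = sed_coeff x i - sed_coeff y i"
  "sed_coeff (- x) i = - sed_coeff x i"
  "sed_coeff (c *\<^sub>S x) i = c * sed_coeff x i"
  "sed_coeff (sed_conj x) i = (if i = 0 then sed_coeff x i else - sed_coeff x i)"
  "sed_coeff (sed_basis s) i = (if i = s \<and> s < 16 then 1 else 0)"
  "sed_coeff (sed_complexify z) i = complex_of_real (sed_coeff z i)"
  by (transfer; simp add: cd_conj_def)+

lemma sed_coeff_sum [simp]: "sed_coeff (sum f A) i = (\<Sum>j\<in>A. sed_coeff (f j) i)"
  by (induction A rule: infinite_finite_induct) simp_all

lemma sed_basis_0: "sed_basis 0 = 1"
  by transfer auto

lemma cd_mult_one:
  "cd_mult k (\<lambda>i. if i = 0 then 1 else 0) x = cd_fst k x"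
  "cd_mult k x (\<lambda>i. if i = 0 then 1 else 0) = cd_fst k x"
  "cd_mult k (\<lambda>_. 0) x = (\<lambda>_. 0)"
  "cd_mult k x (\<lambda>_. 0) = (\<lambda>_. 0)"
proof (induction k arbitrary: x)
  case (Suc k)
  have *: "cd_fst k (\<lambda>i. if i = 0 then 1 else 0) = (\<lambda>i. if i = 0 then 1 else (0::'a))"
    "cd_snd k (\<lambda>i. if i = 0 then 1 else 0) = (\<lambda>_. 0::'a)"
    "cd_fst k (\<lambda>_. 0) = (\<lambda>_. 0::'a)" "cd_snd k (\<lambda>_. 0) = (\<lambda>_. 0::'a)"
    "cd_conj (\<lambda>_. 0) = (\<lambda>_. 0::'a)"
    "cd_conj (\<lambda>i. if i = 0 then 1 else 0) = (\<lambda>i. if i = 0 then 1 else (0::'a))"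
    by (auto simp: cd_fst_def cd_snd_def cd_conj_def fun_eq_iff)
  {
    case 1 show ?case
      by (simp only: cd_mult.simps Let_def * Suc) (auto simp: cd_fst_def cd_snd_def fun_eq_iff)
  next
    case 2 show ?case
      by (simp only: cd_mult.simps Let_def * Suc) (auto simp: cd_fst_def cd_snd_def fun_eq_iff)
  next
    case 3 show ?case by (simp add: Let_def * Suc fun_eq_iff)
  next
    case 4 show ?case by (simp add: Let_def * Suc fun_eq_iff)
  }
qed (auto simp: cd_fst_def fun_eq_iff)

lemma sed_mult_1 [simp]: "1 * x = x" "x * 1 = x" for x :: "'a::comm_ring_1 sedenion"
  by (transfer; auto simp: cd_mult_one cd_fst_def fun_eq_iff)+

lemma cd_mult_of_real:
  "cd_mult k (\<lambda>i. complex_of_real (x i)) (\<lambda>i. complex_of_real (y i)) =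
     (\<lambda>i. complex_of_real (cd_mult k x y i))"
proof (induction k arbitrary: x y)
  case (Suc k)
  have *: "cd_fst k (\<lambda>i. complex_of_real (f i)) = (\<lambda>i. complex_of_real (cd_fst k f i))"
    "cd_snd k (\<lambda>i. complex_of_real (f i)) = (\<lambda>i. complex_of_real (cd_snd k f i))"
    "cd_conj (\<lambda>i. complex_of_real (f i)) = (\<lambda>i. complex_of_real (cd_conj f i))" for f
    by (auto simp: cd_fst_def cd_snd_def cd_conj_def fun_eq_iff)
  show ?case by (simp add: Let_def * Suc fun_eq_iff)
qed (auto simp: fun_eq_iff)

lemma sed_complexify_mult: "sed_complexify (x * y) = sed_complexify x * sed_complexify y"
  by transfer (simp add: cd_mult_of_real)

lemma inj_sed_complexify: "inj sed_complexify"
proof (rule injI)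
  fix x y assume "sed_complexify x = sed_complexify y"
  then have "sed_coeff (sed_complexify x) i = sed_coeff (sed_complexify y) i" for i by simp
  then show "x = y" by (intro sedenion_eqI) simp
qed


section \<open>Tribonacci and Tribonacci-Lucas sedenions\<close>

definition trib_sed :: "int \<Rightarrow> real sedenion" where
  "trib_sed n = (\<Sum>s=0..15. real_of_int (tribonacci (n + int s)) *\<^sub>S sed_basis s)"

definition lucas_sed :: "int \<Rightarrow> real sedenion" where
  "lucas_sed n = (\<Sum>s=0..15. real_of_int (tribonacci_lucas (n + int s)) *\<^sub>S sed_basis s)"

definition trib_sed_conj :: "int \<Rightarrow> real sedenion" where
  "trib_sed_conj n = sed_real (real_of_int (tribonacci n))
     - (\<Sum>s=1..15. real_of_int (tribonacci (n + int s)) *\<^sub>S sed_basis s)"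

definition lucas_sed_conj :: "int \<Rightarrow> real sedenion" where
  "lucas_sed_conj n = sed_real (real_of_int (tribonacci_lucas n))
     - (\<Sum>s=1..15. real_of_int (tribonacci_lucas (n + int s)) *\<^sub>S sed_basis s)"

definition power_sed :: "complex \<Rightarrow> complex sedenion" where
  "power_sed z = (\<Sum>s=0..15. (z ^ s) *\<^sub>S sed_basis s)"

lemma sed_conj_sum:
  "sed_conj (\<Sum>s=0..15. f s *\<^sub>S sed_basis s) =
     f 0 *\<^sub>S sed_basis 0 - (\<Sum>s=1..15. f s *\<^sub>S sed_basis s)"
  for f :: "nat \<Rightarrow> 'a::comm_ring_1"
  by (rule sedenion_eqI) (auto simp: if_distrib [of "\<lambda>x. _ * x"] sum.delta cong: if_cong)

lemma trib_sed_conj_eq: "trib_sed_conj n = sed_conj (trib_sed n)"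
  by (simp add: trib_sed_conj_def trib_sed_def sed_conj_sum sed_real_def)

lemma lucas_sed_conj_eq: "lucas_sed_conj n = sed_conj (lucas_sed n)"
  by (simp add: lucas_sed_conj_def lucas_sed_def sed_conj_sum sed_real_def)

end

theory Submission
  imports Defs
begin

text \<open>
  Both integer sequences satisfy the third-order recurrence with characteristic polynomial
  \<open>x^3 - x^2 - x - 1\<close>, and so does every combination \<open>A \<alpha>^n + B \<beta>^n + C \<gamma>^n\<close> of powers of its
  roots. A solution is determined by its first three values, so a sequence equals such a
  combination as soon as the two agree at \<open>0, 1, 2\<close> (\<open>binet\<close>); for the weights in question this
  is a computation with the elementary symmetric functions of the roots (\<open>root_symmetric\<close>,
  \<open>lagrange_weight_sums\<close>). The same uniqueness principle gives the linear
  relation between the two sequences.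

  Every sedenion identity holds coefficient by coefficient. The coefficient at \<open>s\<close> of the
  sedenion with index \<open>n\<close> is the term of index \<open>n + s\<close>, and this shift multiplies a summand
  \<open>A \<alpha>^n\<close> by \<open>\<alpha>^s\<close>, the coefficient at \<open>s\<close> of \<open>power_sed \<alpha>\<close>. Therefore the Binet formula
  passes to sedenions: adding neighbours produces the factor \<open>\<alpha> + 1\<close>, and a binomial sum
  produces \<open>(1 + \<alpha>)^n\<close> by the binomial theorem.
\<close>

section \<open>Sequences with the Tribonacci recurrence\<close>

lemma tribonacci_type_unique:
  fixes u v :: "nat \<Rightarrow> 'a::comm_ring_1"
  assumes u: "\<And>n. u (n + 3) = u (n + 2) + u (n + 1) + u n"
    and v: "\<And>n. v (n + 3) = v (n + 2) + v (n + 1) + v n"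
    and init: "u 0 = v 0" "u 1 = v 1" "u 2 = v 2"
  shows "u n = v n"
proof -
  \<comment> \<open>Three consecutive agreements have to be carried through the induction at once.\<close>
  have "u n = v n \<and> u (n + 1) = v (n + 1) \<and> u (n + 2) = v (n + 2)"
  proof (induction n)
    case 0
    then show ?case using init by (simp add: numeral_2_eq_2)
  next
    case (Suc n)
    then show ?case using u [of n] v [of n] by (simp add: numeral_3_eq_3)
  qed
  then show ?thesis by simp
qed

lemma tribonacci_step:
  "tribonacci (n + 3) = tribonacci (n + 2) + tribonacci (n + 1) + tribonacci n"
  using tribonacci_rec [of "n + 3"] by (simp add: algebra_simps)

lemma tribonacci_lucas_step:
  "tribonacci_lucas (n + 3) =
     tribonacci_lucas (n + 2) + tribonacci_lucas (n + 1) + tribonacci_lucas n"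
  using tribonacci_lucas_rec [of "n + 3"] by (simp add: algebra_simps)

lemma tribonacci_lucas_eq:
  "tribonacci_lucas (int m) =
     3 * tribonacci (int m + 1) - 2 * tribonacci (int m) - tribonacci (int m - 1)"
proof (rule tribonacci_type_unique [where n = m])
  have "tribonacci (- 1) = 0" "tribonacci 3 = 2"
    using tribonacci_step [of "-1"] tribonacci_step [of 0] by (simp_all add: tribonacci_init)
  then show "tribonacci_lucas (int 0) =
      3 * tribonacci (int 0 + 1) - 2 * tribonacci (int 0) - tribonacci (int 0 - 1)"
    "tribonacci_lucas (int 1) =
      3 * tribonacci (int 1 + 1) - 2 * tribonacci (int 1) - tribonacci (int 1 - 1)"
    "tribonacci_lucas (int 2) =
      3 * tribonacci (int 2 + 1) - 2 * tribonacci (int 2) - tribonacci (int 2 - 1)"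
    by (simp_all add: tribonacci_init tribonacci_lucas_init)
next
  fix n
  show "tribonacci_lucas (int (n + 3)) =
      tribonacci_lucas (int (n + 2)) + tribonacci_lucas (int (n + 1)) + tribonacci_lucas (int n)"
    using tribonacci_lucas_step [of "int n"] by (simp add: ac_simps)
next
  fix n
  have shift: "tribonacci (int n + 3 + 1) = tribonacci (int n + 4)"
    "tribonacci (int n + 3 - 1) = tribonacci (int n + 2)"
    "tribonacci (int n + 2 + 1) = tribonacci (int n + 3)"
    "tribonacci (int n + 2 - 1) = tribonacci (int n + 1)"
    "tribonacci (int n + 1 + 1) = tribonacci (int n + 2)"
    "tribonacci (int n + 1 - 1) = tribonacci (int n)"
    by (simp_all add: algebra_simps)
  show "3 * tribonacci (int (n + 3) + 1) - 2 * tribonacci (int (n + 3))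
        - tribonacci (int (n + 3) - 1) =
      (3 * tribonacci (int (n + 2) + 1) - 2 * tribonacci (int (n + 2))
        - tribonacci (int (n + 2) - 1)) +
      (3 * tribonacci (int (n + 1) + 1) - 2 * tribonacci (int (n + 1))
        - tribonacci (int (n + 1) - 1)) +
      (3 * tribonacci (int n + 1) - 2 * tribonacci (int n) - tribonacci (int n - 1))"
    using tribonacci_step [of "int n - 1"] tribonacci_step [of "int n"]
      tribonacci_step [of "int n + 1"]
    by (simp add: shift algebra_simps)
qed


section \<open>Binet formulas\<close>

lemma binet:
  fixes f :: "int \<Rightarrow> int" and \<alpha> \<beta> \<gamma> A B C :: complex
  assumes rec: "\<And>n. f (n + 3) = f (n + 2) + f (n + 1) + f n"
    and cubic: "\<alpha> ^ 3 = \<alpha> ^ 2 + \<alpha> + 1" "\<beta> ^ 3 = \<beta> ^ 2 + \<beta> + 1" "\<gamma> ^ 3 = \<gamma> ^ 2 + \<gamma> + 1"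
    and init: "of_int (f 0) = A + B + C" "of_int (f 1) = A * \<alpha> + B * \<beta> + C * \<gamma>"
      "of_int (f 2) = A * \<alpha> ^ 2 + B * \<beta> ^ 2 + C * \<gamma> ^ 2"
  shows "of_int (f (int m)) = A * \<alpha> ^ m + B * \<beta> ^ m + C * \<gamma> ^ m"
proof (rule tribonacci_type_unique [where n = m])
  fix n
  show "of_int (f (int (n + 3))) =
      of_int (f (int (n + 2))) + of_int (f (int (n + 1))) + (of_int (f (int n)) :: complex)"
    using rec [of "int n"] by (simp add: ac_simps)
next
  fix n
  show "A * \<alpha> ^ (n + 3) + B * \<beta> ^ (n + 3) + C * \<gamma> ^ (n + 3) =
      (A * \<alpha> ^ (n + 2) + B * \<beta> ^ (n + 2) + C * \<gamma> ^ (n + 2)) +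
      (A * \<alpha> ^ (n + 1) + B * \<beta> ^ (n + 1) + C * \<gamma> ^ (n + 1)) +
      (A * \<alpha> ^ n + B * \<beta> ^ n + C * \<gamma> ^ n)"
    by (simp only: power_add cubic) (simp add: algebra_simps)
qed (use init in simp_all)

text \<open>
  Dividing the difference of two of the cubic equations by the difference of the roots gives a
  quadratic relation, and repeating this once more gives the first of Vieta's formulas; the
  second one follows by substituting it back.
\<close>

lemma root_symmetric:
  fixes \<alpha> \<beta> \<gamma> :: complex
  assumes cubic: "\<alpha> ^ 3 = \<alpha> ^ 2 + \<alpha> + 1" "\<beta> ^ 3 = \<beta> ^ 2 + \<beta> + 1" "\<gamma> ^ 3 = \<gamma> ^ 2 + \<gamma> + 1"
    and ne: "\<alpha> \<noteq> \<beta>" "\<alpha> \<noteq> \<gamma>" "\<beta> \<noteq> \<gamma>"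
  shows "\<alpha> + \<beta> + \<gamma> = 1" and "\<alpha> * \<beta> + \<alpha> * \<gamma> + \<beta> * \<gamma> = -1"
proof -
  have quadratic: "x ^ 2 + x * y + y ^ 2 = x + y + 1"
    if "x ^ 3 = x ^ 2 + x + 1" "y ^ 3 = y ^ 2 + y + 1" "x \<noteq> y" for x y :: complex
  proof -
    have "(x - y) * (x ^ 2 + x * y + y ^ 2 - (x + y + 1)) = 0"
      using that(1,2) by algebra
    then show ?thesis using that(3) by simp
  qed
  note ab = quadratic [OF cubic(1,2) ne(1)] and ac = quadratic [OF cubic(1,3) ne(2)]
  have "(\<beta> - \<gamma>) * (\<alpha> + \<beta> + \<gamma> - 1) = 0"
    using ab ac by algebra
  then show sum: "\<alpha> + \<beta> + \<gamma> = 1" using ne(3) by simp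
  show "\<alpha> * \<beta> + \<alpha> * \<gamma> + \<beta> * \<gamma> = -1"
    using ab sum by algebra
qed

text \<open>
  Each of these sums is the divided difference of a power of \<open>x\<close> at three nodes: a complete
  homogeneous symmetric polynomial in the nodes, of degree \<open>-1\<close>, \<open>0\<close> and \<open>1\<close>.
\<close>

lemma lagrange_weight_sums:
  fixes \<alpha> \<beta> \<gamma> :: complex
  assumes ne: "\<alpha> \<noteq> \<beta>" "\<alpha> \<noteq> \<gamma>" "\<beta> \<noteq> \<gamma>"
  defines "A \<equiv> \<alpha> / ((\<alpha> - \<beta>) * (\<alpha> - \<gamma>))"
    and "B \<equiv> \<beta> / ((\<beta> - \<alpha>) * (\<beta> - \<gamma>))"
    and "C \<equiv> \<gamma> / ((\<gamma> - \<alpha>) * (\<gamma> - \<beta>))"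
  shows "A + B + C = 0"
    and "A * \<alpha> + B * \<beta> + C * \<gamma> = 1"
    and "A * \<alpha> ^ 2 + B * \<beta> ^ 2 + C * \<gamma> ^ 2 = \<alpha> + \<beta> + \<gamma>"
proof -
  \<comment> \<open>All three weights over the common denominator, the Vandermonde determinant.\<close>
  define D where "D = (\<alpha> - \<beta>) * (\<alpha> - \<gamma>) * (\<beta> - \<gamma>)"
  have D: "D \<noteq> 0" using ne by (simp add: D_def)
  have weights: "A = \<alpha> * (\<beta> - \<gamma>) / D" "B = - (\<beta> * (\<alpha> - \<gamma>)) / D" "C = \<gamma> * (\<alpha> - \<beta>) / D"
    using ne by (simp_all add: A_def B_def C_def D_def divide_simps) (simp_all add: algebra_simps)
  have combine: "A * x + B * y + C * z =
      (\<alpha> * (\<beta> - \<gamma>) * x - \<beta> * (\<alpha> - \<gamma>) * y + \<gamma> * (\<alpha> - \<beta>) * z) / D" for x y z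
    by (simp add: weights add_divide_distrib diff_divide_distrib)
  show "A + B + C = 0"
    using combine [of 1 1 1] by (simp add: algebra_simps)
  have "\<alpha> * (\<beta> - \<gamma>) * \<alpha> - \<beta> * (\<alpha> - \<gamma>) * \<beta> + \<gamma> * (\<alpha> - \<beta>) * \<gamma> = D"
    unfolding D_def by algebra
  then show "A * \<alpha> + B * \<beta> + C * \<gamma> = 1"
    unfolding combine using D by simp
  have "\<alpha> * (\<beta> - \<gamma>) * \<alpha> ^ 2 - \<beta> * (\<alpha> - \<gamma>) * \<beta> ^ 2 + \<gamma> * (\<alpha> - \<beta>) * \<gamma> ^ 2 = (\<alpha> + \<beta> + \<gamma>) * D"
    unfolding D_def by algebra
  then show "A * \<alpha> ^ 2 + B * \<beta> ^ 2 + C * \<gamma> ^ 2 = \<alpha> + \<beta> + \<gamma>"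
    unfolding combine using D by simp
qed

lemma binet_tribonacci:
  fixes \<alpha> \<beta> \<gamma> :: complex
  assumes cubic: "\<alpha> ^ 3 = \<alpha> ^ 2 + \<alpha> + 1" "\<beta> ^ 3 = \<beta> ^ 2 + \<beta> + 1" "\<gamma> ^ 3 = \<gamma> ^ 2 + \<gamma> + 1"
    and ne: "\<alpha> \<noteq> \<beta>" "\<alpha> \<noteq> \<gamma>" "\<beta> \<noteq> \<gamma>"
  shows "of_int (tribonacci (int m)) =
      \<alpha> / ((\<alpha> - \<beta>) * (\<alpha> - \<gamma>)) * \<alpha> ^ m
    + \<beta> / ((\<beta> - \<alpha>) * (\<beta> - \<gamma>)) * \<beta> ^ m
    + \<gamma> / ((\<gamma> - \<alpha>) * (\<gamma> - \<beta>)) * \<gamma> ^ m"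
  by (rule binet [OF tribonacci_step cubic])
    (simp_all only: tribonacci_init lagrange_weight_sums [OF ne] root_symmetric(1) [OF cubic ne]
      of_int_0 of_int_1)

lemma binet_tribonacci_lucas:
  fixes \<alpha> \<beta> \<gamma> :: complex
  assumes cubic: "\<alpha> ^ 3 = \<alpha> ^ 2 + \<alpha> + 1" "\<beta> ^ 3 = \<beta> ^ 2 + \<beta> + 1" "\<gamma> ^ 3 = \<gamma> ^ 2 + \<gamma> + 1"
    and ne: "\<alpha> \<noteq> \<beta>" "\<alpha> \<noteq> \<gamma>" "\<beta> \<noteq> \<gamma>"
  shows "of_int (tribonacci_lucas (int m)) = 1 * \<alpha> ^ m + 1 * \<beta> ^ m + 1 * \<gamma> ^ m"
proof (rule binet [OF tribonacci_lucas_step cubic])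
  note sym = root_symmetric [OF cubic ne]
  show "of_int (tribonacci_lucas 1) = 1 * \<alpha> + 1 * \<beta> + 1 * \<gamma>"
    using sym(1) by (simp add: tribonacci_lucas_init)
  have "\<alpha> ^ 2 + \<beta> ^ 2 + \<gamma> ^ 2 = 3"
    using sym by algebra
  then show "of_int (tribonacci_lucas 2) = 1 * \<alpha> ^ 2 + 1 * \<beta> ^ 2 + 1 * \<gamma> ^ 2"
    by (simp add: tribonacci_lucas_init)
qed (simp add: tribonacci_lucas_init)


section \<open>From sequences to sedenions\<close>

lemma sed_coeff_basis_expansion:
  "i < 16 \<Longrightarrow> sed_coeff (\<Sum>s=0..15. f s *\<^sub>S sed_basis s) i = f i"
  for f :: "nat \<Rightarrow> 'a::comm_ring_1"
  by (simp add: if_distrib [of "\<lambda>x. _ * x"] sum.delta cong: if_cong)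

lemma sed_coeff_trib_sed: "i < 16 \<Longrightarrow> sed_coeff (trib_sed n) i = of_int (tribonacci (n + int i))"
  and sed_coeff_lucas_sed:
    "i < 16 \<Longrightarrow> sed_coeff (lucas_sed n) i = of_int (tribonacci_lucas (n + int i))"
  and sed_coeff_power_sed: "i < 16 \<Longrightarrow> sed_coeff (power_sed z) i = z ^ i"
  unfolding trib_sed_def lucas_sed_def power_sed_def by (simp_all only: sed_coeff_basis_expansion)

text \<open>
  The index shift inside a sedenion turns every term \<open>A \<alpha>^m\<close> of a Binet formula into the
  multiple of \<open>power_sed \<alpha>\<close> by the same number.
\<close>

lemma sed_complexify_eq_powers:
  assumes coeff: "\<And>m i. i < 16 \<Longrightarrow>
      complex_of_real (sed_coeff (F (int m)) i) =
        A * \<alpha> ^ (m + i) + B * \<beta> ^ (m + i) + C * \<gamma> ^ (m + i)"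
  shows "sed_complexify (F (int m)) =
      (A * \<alpha> ^ m) *\<^sub>S power_sed \<alpha> + (B * \<beta> ^ m) *\<^sub>S power_sed \<beta> + (C * \<gamma> ^ m) *\<^sub>S power_sed \<gamma>"
  by (rule sedenion_eqI) (simp add: coeff sed_coeff_power_sed power_add mult.assoc)

lemma sed_complexify_neighbour_sum:
  assumes F: "\<And>m. sed_complexify (F (int m)) =
      (A * \<alpha> ^ m) *\<^sub>S U + (B * \<beta> ^ m) *\<^sub>S V + (C * \<gamma> ^ m) *\<^sub>S W"
  shows "sed_complexify (F (int n + 1) + F (int n)) =
      (A * (\<alpha> + 1) * \<alpha> ^ n) *\<^sub>S U + (B * (\<beta> + 1) * \<beta> ^ n) *\<^sub>S V + (C * (\<gamma> + 1) * \<gamma> ^ n) *\<^sub>S W"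
proof -
  have "sed_complexify (F (int n + 1) + F (int n)) =
      sed_complexify (F (int (Suc n))) + sed_complexify (F (int n))"
    by (rule sedenion_eqI) (simp add: add.commute)
  then show ?thesis
    unfolding F by (auto intro!: sedenion_eqI simp: algebra_simps)
qed

lemma sed_complexify_binomial_sum:
  assumes F: "\<And>m. sed_complexify (F (int m)) =
      (A * \<alpha> ^ m) *\<^sub>S U + (B * \<beta> ^ m) *\<^sub>S V + (C * \<gamma> ^ m) *\<^sub>S W"
  shows "sed_complexify (\<Sum>i=0..n. real (n choose i) *\<^sub>S F (int i)) =
      (A * (1 + \<alpha>) ^ n) *\<^sub>S U + (B * (1 + \<beta>) ^ n) *\<^sub>S V + (C * (1 + \<gamma>) ^ n) *\<^sub>S W"
proof (rule sedenion_eqI)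
  fix j
  have F': "complex_of_real (sed_coeff (F (int m)) j) = A * \<alpha> ^ m * sed_coeff U j
      + B * \<beta> ^ m * sed_coeff V j + C * \<gamma> ^ m * sed_coeff W j" for m
    using arg_cong [OF F, of "\<lambda>x. sed_coeff x j"] by simp
  have binom: "(1 + z) ^ n = (\<Sum>i=0..n. of_nat (n choose i) * z ^ i)" for z :: complex
    using binomial_ring [of z 1 n] by (simp add: add.commute atLeast0AtMost)
  show "sed_coeff (sed_complexify (\<Sum>i=0..n. real (n choose i) *\<^sub>S F (int i))) j =
      sed_coeff ((A * (1 + \<alpha>) ^ n) *\<^sub>S U + (B * (1 + \<beta>) ^ n) *\<^sub>S V + (C * (1 + \<gamma>) ^ n) *\<^sub>S W) j"
    by (simp add: F' binom sum_distrib_left sum_distrib_right sum.distrib [symmetric]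
        algebra_simps)
qed

text \<open>Conjugation negates every coefficient except the real one.\<close>

lemma sed_add_conj: "x + sed_conj x = sed_real (2 * sed_coeff x 0)"
  by (rule sedenion_eqI) (simp add: sed_real_def)


section \<open>Tribonacci and Tribonacci-Lucas sedenion identities\<close>

theorem theorem3p1:
  fixes \<alpha> \<beta> \<gamma> :: complex and n :: nat
  assumes roots: "{x :: complex. x ^ 3 - x ^ 2 - x - 1 = 0} = {\<alpha>, \<beta>, \<gamma>}"
    and distinct_roots: "distinct [\<alpha>, \<beta>, \<gamma>]"
    and n: "n \<ge> 1"
  shows
    "(lucas_sed (int n) =
       3 *\<^sub>S trib_sed (int n + 1) - 2 *\<^sub>S trib_sed (int n) - trib_sed (int n - 1))
     \<and> (trib_sed (int n) + trib_sed_conj (int n) = sed_real (2 * real_of_int (tribonacci (int n))))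
     \<and> (lucas_sed (int n) + lucas_sed_conj (int n) =
       sed_real (2 * real_of_int (tribonacci_lucas (int n))))
     \<and> (sed_complexify (trib_sed (int n + 1) + trib_sed (int n)) =
         ((\<alpha> + 1) * \<alpha> ^ (n + 1) / ((\<alpha> - \<beta>) * (\<alpha> - \<gamma>))) *\<^sub>S power_sed \<alpha>
       + ((\<beta> + 1) * \<beta> ^ (n + 1) / ((\<beta> - \<alpha>) * (\<beta> - \<gamma>))) *\<^sub>S power_sed \<beta>
       + ((\<gamma> + 1) * \<gamma> ^ (n + 1) / ((\<gamma> - \<alpha>) * (\<gamma> - \<beta>))) *\<^sub>S power_sed \<gamma>)
     \<and> (sed_complexify (lucas_sed (int n + 1) + lucas_sed (int n)) =
         ((\<alpha> + 1) * \<alpha> ^ n) *\<^sub>S power_sed \<alpha>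
       + ((\<beta> + 1) * \<beta> ^ n) *\<^sub>S power_sed \<beta>
       + ((\<gamma> + 1) * \<gamma> ^ n) *\<^sub>S power_sed \<gamma>)
     \<and> (sed_complexify (\<Sum>i=0..n. real (n choose i) *\<^sub>S trib_sed (int i)) =
         (\<alpha> * (1 + \<alpha>) ^ n / ((\<alpha> - \<beta>) * (\<alpha> - \<gamma>))) *\<^sub>S power_sed \<alpha>
       + (\<beta> * (1 + \<beta>) ^ n / ((\<beta> - \<alpha>) * (\<beta> - \<gamma>))) *\<^sub>S power_sed \<beta>
       + (\<gamma> * (1 + \<gamma>) ^ n / ((\<gamma> - \<alpha>) * (\<gamma> - \<beta>))) *\<^sub>S power_sed \<gamma>)
     \<and> (sed_complexify (\<Sum>i=0..n. real (n choose i) *\<^sub>S lucas_sed (int i)) =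
         ((1 + \<alpha>) ^ n) *\<^sub>S power_sed \<alpha>
       + ((1 + \<beta>) ^ n) *\<^sub>S power_sed \<beta>
       + ((1 + \<gamma>) ^ n) *\<^sub>S power_sed \<gamma>)"
proof -
  have "x ^ 3 = x ^ 2 + x + 1" if "x \<in> {\<alpha>, \<beta>, \<gamma>}" for x
    using that unfolding roots [symmetric] by (simp add: algebra_simps)
  then have cubic: "\<alpha> ^ 3 = \<alpha> ^ 2 + \<alpha> + 1" "\<beta> ^ 3 = \<beta> ^ 2 + \<beta> + 1" "\<gamma> ^ 3 = \<gamma> ^ 2 + \<gamma> + 1"
    by simp_all
  have ne: "\<alpha> \<noteq> \<beta>" "\<alpha> \<noteq> \<gamma>" "\<beta> \<noteq> \<gamma>"
    using distinct_roots by simp_all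
  have T: "sed_complexify (trib_sed (int m)) =
      (\<alpha> / ((\<alpha> - \<beta>) * (\<alpha> - \<gamma>)) * \<alpha> ^ m) *\<^sub>S power_sed \<alpha>
    + (\<beta> / ((\<beta> - \<alpha>) * (\<beta> - \<gamma>)) * \<beta> ^ m) *\<^sub>S power_sed \<beta>
    + (\<gamma> / ((\<gamma> - \<alpha>) * (\<gamma> - \<beta>)) * \<gamma> ^ m) *\<^sub>S power_sed \<gamma>" for m
    by (rule sed_complexify_eq_powers)
      (simp only: sed_coeff_trib_sed of_real_of_int_eq of_nat_add [symmetric]
        binet_tribonacci [OF cubic ne])
  have K: "sed_complexify (lucas_sed (int m)) =
      (1 * \<alpha> ^ m) *\<^sub>S power_sed \<alpha> + (1 * \<beta> ^ m) *\<^sub>S power_sed \<beta> + (1 * \<gamma> ^ m) *\<^sub>S power_sed \<gamma>" for m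
    by (rule sed_complexify_eq_powers)
      (simp only: sed_coeff_lucas_sed of_real_of_int_eq of_nat_add [symmetric]
        binet_tribonacci_lucas [OF cubic ne])
  have a: "lucas_sed (int n) =
      3 *\<^sub>S trib_sed (int n + 1) - 2 *\<^sub>S trib_sed (int n) - trib_sed (int n - 1)"
  proof (rule sedenion_eqI)
    fix i :: nat
    assume "i < 16"
    then show "sed_coeff (lucas_sed (int n)) i =
        sed_coeff (3 *\<^sub>S trib_sed (int n + 1) - 2 *\<^sub>S trib_sed (int n) - trib_sed (int n - 1)) i"
      using tribonacci_lucas_eq [of "n + i"]
      by (simp add: sed_coeff_trib_sed sed_coeff_lucas_sed algebra_simps)
  qed
  have b: "trib_sed (int n) + trib_sed_conj (int n) =
      sed_real (2 * real_of_int (tribonacci (int n)))"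
    "lucas_sed (int n) + lucas_sed_conj (int n) =
      sed_real (2 * real_of_int (tribonacci_lucas (int n)))"
    by (simp_all add: trib_sed_conj_eq lucas_sed_conj_eq sed_add_conj
        sed_coeff_trib_sed sed_coeff_lucas_sed)
  have weight: "x / d * (x + 1) * x ^ n = (x + 1) * x ^ (n + 1) / d"
    "x / d * (1 + x) ^ n = x * (1 + x) ^ n / d" for x d :: complex
    by simp_all
  note c = sed_complexify_neighbour_sum [OF T, of n, unfolded weight]
  note d = sed_complexify_neighbour_sum [OF K, of n, unfolded mult_1_left]
  note e = sed_complexify_binomial_sum [OF T, of n, unfolded weight]
  note f = sed_complexify_binomial_sum [OF K, of n, unfolded mult_1_left]
  show ?thesis
    by (intro conjI a b c d e f)
qed

end
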